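(* Let $0<p,q<+\infty$. Let $u$ and $v$ be two weight functions on $(0,+\infty)$ and let $g:(0,+\infty)\to\mathbb{R}$ be continuous and strictly monotone. Let $w$ be a strictly positive measurable function on $(0,+\infty)$ such that $W(x)=\int_0^x w(s)\,\mathrm{d}s$ is finite for every $x>0$ and $W(+\infty)=+\infty$. Put $$U(x):=\frac{u\left(W^{-1}(x)\right)}{W'\left(W^{-1}(x)\right)},\qquad V(x):=\frac{v\left(W^{-1}(x)\right)}{W'\left(W^{-1}(x)\right)}.$$ Let $C$ be a positive finite constant. Then the inequality $$\left(\int_0^\infty u(x)\Bigl([\mathbf{M}^g_w f](x)\Bigr)^q\,\mathrm{d}x\right)^{1/q}\le C\left(\int_0^\infty v(x) f(x)^p\,\mathrm{d}x\right)^{1/p}$$ holds for all positive measurable functions $f$ on $(0,+\infty)$ for which $\mathbf{M}^g_w f$ is defined if and only if the inequality $$\left(\int_0^\infty U(x)\Bigl([\mathbf{M}^g f](x)\Bigr)^q\,\mathrm{d}x\right)^{1/q}\le C\left(\int_0^\infty V(x) f(x)^p\,\mathrm{d}x\right)^{1/p}$$ holds, with the same constant $C$, for all positive measurable functions $f$ on $(0,+\infty)$ for which $\mathbf{M}^g f$ is defined.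
   Context: A weight (function) on $(0,+\infty)$ is a positive measurable function. For $g$ real, continuous and strictly monotone with inverse $g^{-1}$, $$[\mathbf{M}^g_w f](x)=g^{-1}\left(\frac{1}{W(x)}\int_0^x w(t)\,g(f(t))\,\mathrm{d}t\right),\qquad [\mathbf{M}^g f](x)=g^{-1}\left(\frac1x\int_0^x g(f(t))\,\mathrm{d}t\right),\quad x>0.$$ $\mathbf{M}^g_w f$ (resp. $\mathbf{M}^g f$) is defined when $w\cdot(g\circ f)$ (resp. $g\circ f$) is integrable on $(0,x)$ for every $x>0$. $W^{-1}$ is the inverse function of $W$, and $W'$ is the derivative of $W$ (equal to $w$ almost everywhere), so $U,V$ are defined almost everywhere. Integrals of non-negative functions take values in $[0,+\infty]$. *)

theory Defs
  imports "HOL-Analysis.Analysis"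
begin

text \<open>
  Functions on $(0,+\infty)$ are total functions on the reals whose values outside
  $(0,+\infty)$ are never used.  Measurable means Lebesgue measurable.
\<close>

definition pos_measurable :: "(real \<Rightarrow> real) \<Rightarrow> bool" where
  "pos_measurable f \<longleftrightarrow>
     f \<in> borel_measurable (lebesgue_on {0<..}) \<and> (\<forall>x>0. f x > 0)"

text \<open>Only used for \<open>r > 0\<close>, where \<open>\<infinity>\<^sup>r = \<infinity>\<close>.\<close>

definition ennpow :: "ennreal \<Rightarrow> real \<Rightarrow> ennreal" where
  "ennpow a r = (if a = \<infinity> then \<infinity> else ennreal (enn2real a powr r))"

text \<open>
  \<open>primitive w\<close> is $W$.  Its value is meaningful when \<open>w\<close> is integrable on every
  interval $(0,x)$.
\<close>

definition primitive :: "(real \<Rightarrow> real) \<Rightarrow> real \<Rightarrow> real" where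
  "primitive w x = (\<integral>s. w s \<partial>lebesgue_on {0<..<x})"

definition primitive_inv :: "(real \<Rightarrow> real) \<Rightarrow> real \<Rightarrow> real" where
  "primitive_inv w = inv_into {0<..} (primitive w)"

text \<open>
  \<open>deriv\<close> is unspecified where $W$ is not differentiable, so this function is
  meaningful only almost everywhere.
\<close>

definition change_weight :: "(real \<Rightarrow> real) \<Rightarrow> (real \<Rightarrow> real) \<Rightarrow> real \<Rightarrow> real" where
  "change_weight w u x =
     u (primitive_inv w x) / deriv (primitive w) (primitive_inv w x)"

definition wmean_defined ::
    "(real \<Rightarrow> real) \<Rightarrow> (real \<Rightarrow> real) \<Rightarrow> (real \<Rightarrow> real) \<Rightarrow> bool" where
  "wmean_defined g w f \<longleftrightarrow>
     (\<forall>x>0. integrable (lebesgue_on {0<..<x}) (\<lambda>t. w t * g (f t)))"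

definition wmean ::
    "(real \<Rightarrow> real) \<Rightarrow> (real \<Rightarrow> real) \<Rightarrow> (real \<Rightarrow> real) \<Rightarrow> real \<Rightarrow> real" where
  "wmean g w f x =
     inv_into {0<..} g
       (1 / primitive w x * (\<integral>t. w t * g (f t) \<partial>lebesgue_on {0<..<x}))"

definition mean_defined :: "(real \<Rightarrow> real) \<Rightarrow> (real \<Rightarrow> real) \<Rightarrow> bool" where
  "mean_defined g f \<longleftrightarrow>
     (\<forall>x>0. integrable (lebesgue_on {0<..<x}) (\<lambda>t. g (f t)))"

definition mean :: "(real \<Rightarrow> real) \<Rightarrow> (real \<Rightarrow> real) \<Rightarrow> real \<Rightarrow> real" where
  "mean g f x =
     inv_into {0<..} g (1 / x * (\<integral>t. g (f t) \<partial>lebesgue_on {0<..<x}))"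

end

theory Submission
  imports Defs
begin

text \<open>
  The primitive $W$ of $w$ is an increasing bijection of $(0,\infty)$ that carries the measure
  $w\,\mathrm{d}x$ to Lebesgue measure.  As $w > 0$, both $W$ and $W^{-1}$ preserve null sets, so
  they are Lebesgue measurable in both directions, and $W' = w$ almost everywhere.  The substitution
  $f = h \circ W$ is therefore a bijection between the admissible functions of the two inequalities;
  it turns $\mathbf{M}^g_w f$ into $(\mathbf{M}^g h) \circ W$, and the two sides of one inequality
  into the corresponding sides of the other.
\<close>

section \<open>Antiderivatives of positive functions on the real line\<close>

text \<open>This is Lebesgue differentiation. \<open>integrable_ccontinuous_explicit\<close>
  concerns averages over \<open>{x..x + h}\<close> with \<open>h > 0\<close>, that is, right-hand
  difference quotients. Left-hand quotients at \<open>x\<close> are right-hand quotients at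
  \<open>- x\<close> for the reflected function, so the exceptional set is \<open>N1\<close>
  together with the reflection of \<open>N2\<close>.\<close>

lemma AE_has_real_derivative_integral:
  fixes F f :: "real \<Rightarrow> real"
  assumes F: "\<And>a b. a \<le> b \<Longrightarrow> (f has_integral (F b - F a)) {a..b}"
  shows "AE x in lebesgue. (F has_real_derivative f x) (at x)"
proof -
  have "f integrable_on cbox a b" for a b
    using F[of a b] by (cases "a \<le> b") (auto simp: integrable_on_def)
  from integrable_ccontinuous_explicit[OF this] obtain N1 where N1: "negligible N1"
    "\<And>x e. x \<notin> N1 \<Longrightarrow> 0 < e \<Longrightarrow>
      \<exists>d>0. \<forall>h. 0 < h \<and> h < d \<longrightarrow> norm (integral {x..x + h} f / h - f x) < e"
    by (auto simp: divide_inverse mult.commute)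
  have F': "((\<lambda>x. f (- x)) has_integral (F (- a) - F (- b))) {a..b}" if "a \<le> b" for a b
    using F[of "-b" "-a"] that by (subst has_integral_reflect_real[symmetric]) auto
  have "(\<lambda>x. f (- x)) integrable_on cbox a b" for a b
    using F'[of a b] by (cases "a \<le> b") (auto simp: integrable_on_def)
  from integrable_ccontinuous_explicit[OF this] obtain N2 where N2: "negligible N2"
    "\<And>x e. x \<notin> N2 \<Longrightarrow> 0 < e \<Longrightarrow>
      \<exists>d>0. \<forall>h. 0 < h \<and> h < d \<longrightarrow> norm (integral {x..x + h} (\<lambda>x. f (- x)) / h - f (- x)) < e"
    by (auto simp: divide_inverse mult.commute)
  have "(F has_real_derivative f x) (at x)" if x: "x \<notin> N1 \<union> uminus ` N2" for x
    unfolding DERIV_def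
  proof (rule LIM_I)
    fix e :: real assume e: "0 < e"
    from x have x': "x \<notin> N1" "- x \<notin> N2" by force+
    obtain d1 where d1: "d1 > 0"
      "\<And>h. 0 < h \<Longrightarrow> h < d1 \<Longrightarrow> norm (integral {x..x + h} f / h - f x) < e"
      using N1(2)[OF x'(1) e] by blast
    obtain d2 where d2: "d2 > 0"
      "\<And>h. 0 < h \<Longrightarrow> h < d2 \<Longrightarrow>
        norm (integral {-x..-x + h} (\<lambda>x. f (- x)) / h - f x) < e"
      using N2(2)[OF x'(2) e] by auto
    have "norm ((F (x + h) - F x) / h - f x) < e" if h: "h \<noteq> 0" "\<bar>h\<bar> < min d1 d2" for h
    proof (cases "h > 0")
      case True
      then show ?thesis
        using d1(2)[of h] F[of x "x + h"] h by (auto simp: integral_unique)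
    next
      case False
        have "integral {- x..- x + - h} (\<lambda>x. f (- x)) = F x - F (x + h)"
          using integral_unique[OF F'[of "- x" "- x + - h"]] False by (simp add: add.commute)
        moreover have "(F x - F (x + h)) / - h = (F (x + h) - F x) / h"
          by (metis minus_diff_eq minus_divide_divide)
        ultimately show ?thesis
          using d2(2)[of "- h"] False h by simp
    qed
    then show "\<exists>s>0. \<forall>h. h \<noteq> 0 \<and> norm (h - 0) < s \<longrightarrow> norm ((F (x + h) - F x) / h - f x) < e"
      using d1(1) d2(1) by (intro exI[of _ "min d1 d2"]) auto
  qed
  moreover have "negligible (N1 \<union> uminus ` N2)"
    using N1(1) N2(1) by (auto intro!: negligible_differentiable_image_negligible derivative_intros)
  ultimately show ?thesis
    unfolding eventually_ae_filter_negligible by blast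
qed

lemma nn_integral_Ioo_has_integral:
  fixes F f :: "real \<Rightarrow> real"
  assumes pos: "\<And>x. 0 < f x" and F: "(f has_integral (F b - F a)) {a..b}"
  shows "(\<integral>\<^sup>+x. ennreal (f x) * indicator {a<..<b} x \<partial>lebesgue) = ennreal (F b - F a)"
proof -
  have "(f has_integral (F b - F a)) {a<..<b}"
    using F by (simp add: has_integral_Icc_iff_Ioo)
  then have "(\<integral>\<^sup>+x. ennreal (f x) * indicator {a<..<b} x \<partial>lborel) = ennreal (F b - F a)"
    using pos by (intro nn_integral_has_integral_lebesgue') (auto intro: less_imp_le)
  then show ?thesis
    by (simp add: nn_integral_completion)
qed

text \<open>If \<open>F b \<le> F a\<close>, the integral of \<open>f\<close> over
  \<open>{a<..<b}\<close> would vanish, and positivity of \<open>f\<close> would make this nonempty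
  interval a null set.\<close>

lemma strict_mono_antiderivative:
  fixes F f :: "real \<Rightarrow> real"
  assumes pos: "\<And>x. 0 < f x" and meas: "f \<in> borel_measurable lebesgue"
    and F: "\<And>a b. a \<le> b \<Longrightarrow> (f has_integral (F b - F a)) {a..b}"
  shows "strict_mono F"
proof (rule strict_monoI)
  fix a b :: real assume "a < b"
  show "F a < F b"
  proof (rule ccontr)
    assume "\<not> F a < F b"
    \<comment> \<open>A nonpositive difference \<open>F b - F a\<close> is truncated to 0 by
      \<open>ennreal\<close>.\<close>
    then have "(\<integral>\<^sup>+x. ennreal (f x) * indicator {a<..<b} x \<partial>lebesgue) = 0"
      using nn_integral_Ioo_has_integral[of f F b a] pos F \<open>a < b\<close> by (simp add: ennreal_neg)
    then have "AE x in lebesgue. ennreal (f x) * indicator {a<..<b} x = 0"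
      using meas by (subst (asm) nn_integral_0_iff_AE) (auto intro!: borel_measurable_times_ennreal borel_measurable_indicator)
    then have "AE x in lebesgue. x \<notin> {a<..<b}"
      by (rule AE_mp) (auto intro!: AE_I2 simp: ennreal_eq_0_iff pos[THEN linorder_not_le[THEN iffD2]])
    then have "emeasure lebesgue {a<..<b} = 0"
      by (subst (asm) AE_iff_measurable[of "{a<..<b}"]) auto
    then show False
      using \<open>a < b\<close> by (simp add: ennreal_eq_0_iff)
  qed
qed

text \<open>The preimage of \<open>{l<..<u}\<close> under \<open>F\<close> is
  \<open>{inv F l<..<inv F u}\<close>, to which \<open>density lebesgue f\<close> gives mass
  \<open>u - l\<close>; hence the image measure agrees with Lebesgue measure on Borel sets. The
  passage from Borel to Lebesgue sets rests on null sets being preserved in both directions, which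
  positivity of \<open>f\<close> provides.\<close>

lemma 
  fixes F f :: "real \<Rightarrow> real"
  assumes pos: "\<And>x. 0 < f x" and meas: "f \<in> borel_measurable lebesgue"
    and F: "\<And>a b. a \<le> b \<Longrightarrow> (f has_integral (F b - F a)) {a..b}"
    and surj: "surj F"
  shows measurable_antiderivative: "F \<in> lebesgue \<rightarrow>\<^sub>M lebesgue"
    and measurable_inv_antiderivative: "inv F \<in> lebesgue \<rightarrow>\<^sub>M lebesgue"
    and distr_density_antiderivative: "distr (density lebesgue f) lebesgue F = lebesgue"
proof -
  have mono: "strict_mono F"
    using strict_mono_antiderivative[of f F] assms by blast
  then have inj: "inj F" by (rule strict_mono_imp_inj_on)
  have FG[simp]: "F (inv F y) = y" for y using surj by (rule surj_f_inv_f)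
  have GF[simp]: "inv F (F x) = x" for x using inj by (rule inv_f_f)
  have F_borel: "F \<in> borel_measurable borel"
    using mono by (intro borel_measurable_mono strict_mono_mono)
  have "strict_mono (inv F)"
    by (rule strict_monoI) (metis FG mono strict_mono_less)
  then have G_borel: "inv F \<in> borel_measurable borel"
    by (intro borel_measurable_mono strict_mono_mono)
  define D where "D = density lebesgue f"
  have [simp]: "sets D = sets lebesgue" "space D = UNIV" by (auto simp: D_def)
  have null_D: "null_sets D = null_sets lebesgue"
  proof -
    have "N \<in> null_sets D \<longleftrightarrow> N \<in> null_sets lebesgue" for N
      unfolding D_def using meas pos
      by (subst null_sets_density_iff)
        (auto simp: ennreal_eq_0_iff linorder_not_le[symmetric] AE_iff_null_sets[symmetric] intro: AE_not_in)
    then show ?thesis by blast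
  qed
  \<comment> \<open>Having the same sets and null sets as Lebesgue measure, \<open>D\<close> is
    complete, so measurability into \<open>lborel\<close> can be lifted to the completion.\<close>
  interpret D: complete_measure D
  proof
    fix A B assume "B \<subseteq> A" "A \<in> null_sets D"
    then have "B \<in> null_sets lebesgue"
      by (metis null_D null_sets_completion_subset)
    then show "B \<in> sets D" by auto
  qed
  have F_meas: "F \<in> D \<rightarrow>\<^sub>M lborel"
    unfolding measurable_cong_sets[OF \<open>sets D = sets lebesgue\<close> refl]
    using F_borel by (intro measurable_completion) simp
  have lborel: "lborel = distr D lborel F"
  proof (rule lborel_eqI)
    fix l u :: real assume "\<And>b. b \<in> Basis \<Longrightarrow> l \<bullet> b \<le> u \<bullet> b"
    then have le: "l \<le> u" by simp
    then have le': "inv F l \<le> inv F u"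
      using \<open>strict_mono (inv F)\<close> by (simp add: strict_mono_less_eq)
    have "F -` {l<..<u} = {inv F l<..<inv F u}"
      using mono by (auto simp: strict_mono_less) (metis FG mono strict_mono_less)+
    then have "emeasure (distr D lborel F) {l<..<u} = emeasure D {inv F l<..<inv F u}"
      using F_meas by (simp add: emeasure_distr)
    also have "\<dots> = ennreal (u - l)"
      unfolding D_def using meas nn_integral_Ioo_has_integral[of f F "inv F u" "inv F l"] pos F[OF le']
      by (subst emeasure_density) auto
    finally show "emeasure (distr D lborel F) (box l u) = (\<Prod>b\<in>Basis. (u - l) \<bullet> b)"
      by simp
  qed simp
  \<comment> \<open>By the identity just proved, preimages under \<open>F\<close> of Borel null sets
    are null for \<open>D\<close>; completeness then handles all Lebesgue sets.\<close>
  have F_leb: "F \<in> D \<rightarrow>\<^sub>M lebesgue"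
    using D.measurable_completion2[OF F_meas] lborel by simp
  then show "F \<in> lebesgue \<rightarrow>\<^sub>M lebesgue"
    by (simp only: measurable_cong_sets[OF \<open>sets D = sets lebesgue\<close> refl])
  have "completion (distr D lborel F) = distr D lebesgue F"
    using D.completion_distr_eq[OF F_meas] lborel by simp
  then show "distr (density lebesgue f) lebesgue F = lebesgue"
    using lborel by (simp add: D_def)
  have G_meas: "inv F \<in> lebesgue \<rightarrow>\<^sub>M lborel"
    using G_borel by (intro measurable_completion) simp
  show "inv F \<in> lebesgue \<rightarrow>\<^sub>M lebesgue"
  proof (rule completion.measurable_completion2[OF G_meas], rule subsetI)
    fix N :: "real set" assume N: "N \<in> null_sets lborel"
    then have "N \<in> null_sets D"
      using null_D null_sets_completionI by blast
    have vimage: "inv F -` N \<in> sets lborel"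
      using measurable_sets[OF G_borel, of N] N by auto
    \<comment> \<open>The preimage of \<open>N\<close> under \<open>inv F\<close> is the image of
      \<open>N\<close> under \<open>F\<close>, whose Lebesgue measure is the integral of
      \<open>f\<close> over the null set \<open>N\<close>.\<close>
    have "emeasure lborel (inv F -` N) = emeasure (distr D lborel F) (inv F -` N)"
      using lborel by simp
    also have "\<dots> = emeasure D (F -` inv F -` N)"
      using vimage F_meas by (simp add: emeasure_distr)
    also have "F -` inv F -` N = N" by auto
    also have "emeasure D N = 0" using \<open>N \<in> null_sets D\<close> by auto
    finally show "N \<in> null_sets (distr lebesgue lborel (inv F))"
      using N G_meas vimage by (auto simp: null_sets_def emeasure_distr)
  qed
qed

text \<open>
  Off the range of \<open>g\<close> the function \<open>inv_into A g\<close> takes one constant junk value, so no proof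
  that the averages lie in the range of \<open>g\<close> is needed.
\<close>

lemma borel_measurable_inv_into_strict_mono:
  fixes g :: "real \<Rightarrow> real"
  assumes A: "open A" and cont: "continuous_on A g"
    and mono: "strict_mono_on A g \<or> strict_antimono_on A g"
  shows "inv_into A g \<in> borel_measurable borel"
proof -
  have inj: "inj_on g A"
    using mono by (auto simp: inj_on_def monotone_on_def) (metis less_irrefl linorder_neqE)+
  \<comment> \<open>The image is open, hence Borel, so measurability on it extends to the whole
    line.\<close>
  have "open (g ` A)"
    using injective_into_1d_imp_open_map_UNIV[OF A cont inj] by simp
  have "inv_into A g \<in> borel_measurable (restrict_space borel (g ` A))"
    using mono
  proof
    assume *: "strict_mono_on A g"
    have "mono_on (g ` A) (inv_into A g)"
      using inj by (auto simp: mono_on_def strict_mono_on_leD[OF *] strict_mono_on_less_eq[OF *])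
    then show ?thesis by (rule borel_measurable_mono_on_fnc)
  next
    assume *: "strict_antimono_on A g"
    have "mono_on (g ` A) (\<lambda>y. - inv_into A g y)"
      using inj * by (auto simp: mono_on_def monotone_on_def) (meson leD linorder_le_less_linear)
    then have "(\<lambda>y. - inv_into A g y) \<in> borel_measurable (restrict_space borel (g ` A))"
      by (rule borel_measurable_mono_on_fnc)
    then show ?thesis by simp
  qed
  moreover have "inv_into A g = (\<lambda>y. if y \<in> g ` A then inv_into A g y else (SOME x. False))"
  proof
    fix y
    show "inv_into A g y = (if y \<in> g ` A then inv_into A g y else (SOME x. False))"
    proof (cases "y \<in> g ` A")
      case False
      then have "(\<lambda>x. x \<in> A \<and> g x = y) = (\<lambda>x. False)" by auto
      with False show ?thesis by (simp add: inv_into_def)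
    qed simp
  qed
  ultimately show ?thesis
    using \<open>open (g ` A)\<close>
    by (subst (asm) measurable_restrict_space_iff[where c = "SOME x. False"]) auto
qed

section \<open>The primitive \<open>W\<close> as a change of variables on the half-line\<close>

locale divergent_weight =
  fixes w :: "real \<Rightarrow> real"
  assumes pos_meas: "pos_measurable w"
    and finite_primitive: "\<And>x. 0 < x \<Longrightarrow> (\<integral>\<^sup>+s. ennreal (w s) \<partial>lebesgue_on {0<..<x}) < \<infinity>"
    and infinite_total: "(\<integral>\<^sup>+s. ennreal (w s) \<partial>lebesgue_on {0<..}) = \<infinity>"
begin

abbreviation L :: "real measure" where "L \<equiv> lebesgue_on {0<..}"

abbreviation W :: "real \<Rightarrow> real" where "W \<equiv> primitive w"

abbreviation W_inv :: "real \<Rightarrow> real" where "W_inv \<equiv> primitive_inv w"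

text \<open>
  Extending \<open>w\<close> by \<open>1\<close> and \<open>W\<close> by the identity makes the results for the whole line
  applicable.
\<close>

definition w_ext :: "real \<Rightarrow> real" where "w_ext x = (if 0 < x then w x else 1)"

definition W_ext :: "real \<Rightarrow> real" where "W_ext x = (if 0 < x then W x else x)"

lemma w_pos: "0 < x \<Longrightarrow> 0 < w x"
  and w_measurable[measurable]: "w \<in> borel_measurable L"
  using pos_meas by (auto simp: pos_measurable_def)

lemma w_measurable_Ioo: "w \<in> borel_measurable (lebesgue_on {0<..<x})"
  using w_measurable by (rule measurable_restrict_mono) auto

lemma w_integrable: "integrable (lebesgue_on {0<..<x}) w"
proof (cases "0 < x")
  case True
  have "(\<integral>\<^sup>+s. ennreal (norm (w s)) \<partial>lebesgue_on {0<..<x}) = (\<integral>\<^sup>+s. ennreal (w s) \<partial>lebesgue_on {0<..<x})"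
    by (rule nn_integral_cong) (simp add: w_pos less_imp_le)
  then show ?thesis
    using finite_primitive[OF True] w_measurable_Ioo by (intro integrableI_bounded) auto
next
  case False
  then show ?thesis by simp
qed

lemma W_has_integral: "(w has_integral W x) {0..x}"
  using has_integral_integral_lebesgue_on[OF w_integrable[of x]]
  by (simp add: has_integral_Icc_iff_Ioo primitive_def)

lemma W_0[simp]: "W 0 = 0"
  by (simp add: primitive_def)

lemma w_has_integral_diff:
  assumes "0 \<le> a" "a \<le> b"
  shows "(w has_integral W b - W a) {a..b}"
proof -
  have "w integrable_on {0..b}" using W_has_integral by blast
  then have "w integrable_on {a..b}"
    using assms by (auto intro: integrable_on_subinterval)
  moreover have "integral {0..a} w + integral {a..b} w = integral {0..b} w"
    using assms \<open>w integrable_on {0..b}\<close> by (intro Henstock_Kurzweil_Integration.integral_combine)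
  ultimately show ?thesis
    using integral_unique[OF W_has_integral[of a]] integral_unique[OF W_has_integral[of b]]
    by (simp add: has_integral_iff)
qed

lemma W_ext_has_integral:
  assumes "a \<le> b"
  shows "(w_ext has_integral W_ext b - W_ext a) {a..b}"
proof -
  have nonneg: "(w_ext has_integral W_ext b - W_ext a) {a..b}" if "0 \<le> a" "a \<le> b" for a b
  \<comment> \<open>\<open>w_ext 0\<close> is 1 while \<open>w 0\<close> is arbitrary; a single
    point does not affect the integral.\<close>
  proof (rule has_integral_spike_finite[of "{0}"])
    show "(w has_integral W_ext b - W_ext a) {a..b}"
      using w_has_integral_diff[OF that] that by (cases "b = 0") (auto simp: W_ext_def)
  qed (use that in \<open>auto simp: w_ext_def\<close>)
  have nonpos: "(w_ext has_integral W_ext b - W_ext a) {a..b}" if "b \<le> 0" "a \<le> b" for a b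
  proof (rule has_integral_eq)
    show "((\<lambda>x. 1) has_integral W_ext b - W_ext a) {a..b}"
      using has_integral_const_real[of "1::real" a b] that by (auto simp: W_ext_def)
  qed (use that in \<open>auto simp: w_ext_def\<close>)
  show ?thesis
  proof (cases "a < 0 \<and> 0 < b")
    case True
    then show ?thesis
      using has_integral_combine[OF _ _ nonpos[of 0 a] nonneg[of 0 b]] by simp
  next
    case False
    then show ?thesis
      using nonneg nonpos assms by force
  qed
qed

lemma w_ext_pos: "0 < w_ext x"
  by (simp add: w_ext_def w_pos)

lemma w_ext_measurable: "w_ext \<in> borel_measurable lebesgue"
proof -
  have "w_ext = (\<lambda>x. (if x \<in> {0<..} then w x else 0) + indicator {..0} x)"
    by (auto simp: w_ext_def fun_eq_iff)
  moreover have "(\<lambda>x. if x \<in> {0<..} then w x else 0) \<in> borel_measurable lebesgue"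
    by (rule borel_measurable_if_I[OF w_measurable]) simp
  ultimately show ?thesis
    by (auto intro!: borel_measurable_add borel_measurable_indicator)
qed

lemma W_ext_strict_mono: "strict_mono W_ext"
  using strict_mono_antiderivative[OF w_ext_pos w_ext_measurable W_ext_has_integral] .

lemma W_pos: "0 < x \<Longrightarrow> 0 < W x"
  using strict_monoD[OF W_ext_strict_mono, of 0 x] by (simp add: W_ext_def)

lemma W_less_iff: "0 < x \<Longrightarrow> 0 < y \<Longrightarrow> W x < W y \<longleftrightarrow> x < y"
  using strict_mono_less[OF W_ext_strict_mono, of x y] by (simp add: W_ext_def)

text \<open>A bound for \<open>W\<close> would bound the integrals of \<open>w\<close> over all
  \<open>{0<..<real n}\<close> and, by monotone convergence, the total mass, which is
  infinite.\<close>

lemma W_unbounded: "\<exists>n>0. y < W n"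
proof (rule ccontr)
  assume *: "\<not> ?thesis"
  define f where "f n x = ennreal (w x) * indicator {0<..<real n} x" for n x
  have [measurable]: "f n \<in> borel_measurable L" for n
    unfolding f_def by (intro borel_measurable_times_ennreal borel_measurable_indicator) (auto simp: sets_restrict_space_iff)
  have "(\<integral>\<^sup>+x. f n x \<partial>L) \<le> ennreal y" for n
  proof -
    have "(\<integral>\<^sup>+x. f n x \<partial>L) = (\<integral>\<^sup>+x. ennreal (w x) \<partial>lebesgue_on {0<..<real n})"
      unfolding f_def by (subst (1 2) nn_integral_restrict_space)
        (auto intro!: nn_integral_cong split: split_indicator)
    also have "\<dots> = ennreal (W n)"
      unfolding primitive_def using w_integrable
      by (intro nn_integral_eq_integral) (auto intro!: AE_I2 simp: w_pos less_imp_le)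
    \<comment> \<open>The negated claim bounds \<open>W\<close> at positive arguments; the case
      \<open>n = 0\<close> is settled by \<open>W 0 = 0\<close>.\<close>
    also have "\<dots> \<le> ennreal y"
      using *[simplified, rule_format, of "real n"] *[simplified, rule_format, of 1] W_pos[of 1]
      by (cases "n = 0") (auto simp: not_less intro!: ennreal_leI)
    finally show ?thesis .
  qed
  then have "(SUP n. \<integral>\<^sup>+x. f n x \<partial>L) \<le> ennreal y"
    by (intro SUP_least)
  moreover have "(SUP n. \<integral>\<^sup>+x. f n x \<partial>L) = (\<integral>\<^sup>+x. (SUP n. f n x) \<partial>L)"
    by (subst nn_integral_monotone_convergence_SUP)
      (auto simp: f_def incseq_def le_fun_def split: split_indicator)
  moreover have "(\<integral>\<^sup>+x. (SUP n. f n x) \<partial>L) = (\<integral>\<^sup>+x. ennreal (w x) \<partial>L)"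
  proof (rule nn_integral_cong)
    fix x assume "x \<in> space L"
    then have "0 < x" by simp
    show "(SUP n. f n x) = ennreal (w x)"
    proof (rule antisym)
      show "(SUP n. f n x) \<le> ennreal (w x)"
        by (rule SUP_least) (auto simp: f_def split: split_indicator)
      obtain n where "x < real n" using reals_Archimedean2 by blast
      then have "ennreal (w x) = f n x" using \<open>0 < x\<close> by (simp add: f_def)
      then show "ennreal (w x) \<le> (SUP n. f n x)" by (metis SUP_upper UNIV_I)
    qed
  qed
  ultimately show False using infinite_total by (simp add: top_unique)
qed

text \<open>Positive values are attained by the intermediate value theorem, \<open>W\<close> being
  continuous as an indefinite integral and unbounded; the others come from the identity
  branch.\<close>

lemma W_ext_surj: "surj W_ext"
proof -
  have "\<exists>x. y = W_ext x" for y
  proof (cases "0 < y")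
    case True
    obtain n where n: "n > 0" "y < W n" using W_unbounded by blast
    have "w integrable_on {0..n}" using W_has_integral by blast
    then have "continuous_on {0..n} (\<lambda>x. integral {0..x} w)"
      by (rule indefinite_integral_continuous_1)
    then have "continuous_on {0..n} W"
      by (simp add: integral_unique[OF W_has_integral])
    then obtain x where "0 \<le> x" "W x = y"
      using IVT'[of W 0 y n] n True by auto
    with True show ?thesis
      by (intro exI[of _ x]) (cases "x = 0", auto simp: W_ext_def)
  next
    case False
    then show ?thesis by (intro exI[of _ y]) (simp add: W_ext_def)
  qed
  then show ?thesis by (auto simp: surj_def)
qed

lemma bij_betw_W: "bij_betw W {0<..} {0<..}"
  unfolding bij_betw_def
proof
  show "inj_on W {0<..}"
    using W_less_iff by (intro inj_onI) (metis greaterThan_iff less_irrefl linorder_neqE)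
  have "\<exists>x>0. y = W x" if "0 < y" for y
  proof -
    obtain x where "y = W_ext x" using W_ext_surj by blast
    with that show ?thesis by (intro exI[of _ x]) (auto simp: W_ext_def split: if_splits)
  qed
  then show "W ` {0<..} = {0<..}"
    using W_pos by auto
qed

lemma W_inv_pos: "0 < y \<Longrightarrow> 0 < W_inv y"
  unfolding primitive_inv_def
  using inv_into_into[of y W "{0<..}"] bij_betw_W by (auto simp: bij_betw_def)

lemma W_W_inv: "0 < y \<Longrightarrow> W (W_inv y) = y"
  unfolding primitive_inv_def using bij_betw_inv_into_right[OF bij_betw_W] by auto

lemma W_inv_W: "0 < x \<Longrightarrow> W_inv (W x) = x"
  unfolding primitive_inv_def using bij_betw_inv_into_left[OF bij_betw_W] by auto

lemma W_inv_eq_inv_W_ext: "0 < y \<Longrightarrow> W_inv y = inv W_ext y"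
  using W_inv_pos W_W_inv W_ext_strict_mono
  by (metis W_ext_def inv_f_f strict_mono_imp_inj_on)

text \<open>The target carries the Lebesgue sets, so that composing a merely Lebesgue measurable
  function with \<open>W\<close> stays measurable; continuity of \<open>W\<close> alone would not
  give this.\<close>

lemma measurable_W[measurable]: "W \<in> L \<rightarrow>\<^sub>M L"
proof (rule measurable_restrict_space2)
  have "W_ext \<in> L \<rightarrow>\<^sub>M lebesgue"
    by (intro measurable_restrict_space1 measurable_antiderivative[OF w_ext_pos w_ext_measurable W_ext_has_integral W_ext_surj])
  then show "W \<in> L \<rightarrow>\<^sub>M lebesgue"
    by (subst measurable_cong[where g = W_ext]) (auto simp: W_ext_def)
qed (auto simp: W_pos)

lemma measurable_W_inv[measurable]: "W_inv \<in> L \<rightarrow>\<^sub>M L"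
proof (rule measurable_restrict_space2)
  have "inv W_ext \<in> L \<rightarrow>\<^sub>M lebesgue"
    by (intro measurable_restrict_space1 measurable_inv_antiderivative[OF w_ext_pos w_ext_measurable W_ext_has_integral W_ext_surj])
  then show "W_inv \<in> L \<rightarrow>\<^sub>M lebesgue"
    by (subst measurable_cong[where g = "inv W_ext"]) (auto simp: W_inv_eq_inv_W_ext)
qed (auto simp: W_inv_pos)

lemma distr_density_W: "distr (density L w) L W = L"
proof (rule measure_eqI)
  fix A assume "A \<in> sets (distr (density L w) L W)"
  then have AL: "A \<in> sets L" by simp
  then have A: "A \<in> sets lebesgue" "A \<subseteq> {0<..}"
    by (auto simp: sets_restrict_space_iff)
  note meas = measurable_antiderivative[OF w_ext_pos w_ext_measurable W_ext_has_integral W_ext_surj]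
  have "emeasure L A = emeasure (distr (density lebesgue w_ext) lebesgue W_ext) A"
    using A distr_density_antiderivative[OF w_ext_pos w_ext_measurable W_ext_has_integral W_ext_surj]
    by (simp add: emeasure_restrict_space)
  also have "\<dots> = emeasure (density lebesgue w_ext) (W_ext -` A)"
    using A meas by (subst emeasure_distr) auto
  also have "\<dots> = (\<integral>\<^sup>+x. ennreal (w_ext x) * indicator (W_ext -` A) x \<partial>lebesgue)"
    using measurable_sets[OF meas A(1)] w_ext_measurable by (subst emeasure_density) auto
  \<comment> \<open>\<open>W_ext\<close> fixes nonpositive points, so the preimage of
    \<open>A\<close>, a set of positive reals, lies in \<open>{0<..}\<close>, where
    \<open>w_ext\<close> and \<open>W_ext\<close> agree with \<open>w\<close> and
    \<open>W\<close>.\<close>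
  also have "\<dots> = (\<integral>\<^sup>+x. ennreal (w x) * indicator (W -` A \<inter> space L) x \<partial>L)"
    using A(2)
    by (subst nn_integral_restrict_space)
      (auto intro!: nn_integral_cong simp: w_ext_def W_ext_def split: split_indicator)
  also have "\<dots> = emeasure (density L w) (W -` A \<inter> space L)"
    using measurable_sets[OF measurable_W AL] by (subst emeasure_density) auto
  also have "\<dots> = emeasure (distr (density L w) L W) A"
    using AL by (subst emeasure_distr) auto
  finally show "emeasure (distr (density L w) L W) A = emeasure L A" ..
qed simp

text \<open>Differentiation applies to \<open>W_ext\<close> on the whole line, and \<open>W\<close>
  has the same derivative on the open set \<open>{0<..}\<close>. This identifies the denominator in
  \<open>change_weight\<close>.\<close>

lemma AE_deriv_W: "AE x in L. deriv W x = w x"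
proof -
  have deriv: "deriv W x = w x" if "(W_ext has_real_derivative w_ext x) (at x)" "0 < x" for x
  proof -
    have "(W_ext has_real_derivative w x) (at x)"
      using that by (simp add: w_ext_def)
    then have "(W has_real_derivative w x) (at x)"
      by (rule has_field_derivative_transform_within_open[where S = "{0<..}"])
        (use \<open>0 < x\<close> in \<open>auto simp: W_ext_def\<close>)
    then show ?thesis by (rule DERIV_imp_deriv)
  qed
  have "AE x in lebesgue. (W_ext has_real_derivative w_ext x) (at x)"
    by (rule AE_has_real_derivative_integral[OF W_ext_has_integral])
  then have "AE x in lebesgue. x \<in> {0<..} \<longrightarrow> deriv W x = w x"
    by (rule eventually_mono) (simp add: deriv)
  then show ?thesis
    by (subst AE_restrict_space_iff) simp_all
qed

text \<open>The preimage of a null set \<open>N\<close> under \<open>W_inv\<close> is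
  \<open>W\<close> followed by \<open>N\<close> as an image, and by \<open>distr_density_W\<close>
  its measure is the integral of \<open>w\<close> over \<open>N\<close>. The denominator in
  \<open>change_weight\<close> is evaluated at \<open>W_inv y\<close>, hence the need for this
  transfer.\<close>

lemma AE_W_inv:
  assumes "AE x in L. P x"
  shows "AE y in L. P (W_inv y)"
proof -
  obtain N where N: "{x \<in> space L. \<not> P x} \<subseteq> N" "N \<in> null_sets L"
    using assms by (auto simp: eventually_ae_filter)
  have "emeasure L (W_inv -` N \<inter> space L) = emeasure (distr (density L w) L W) (W_inv -` N \<inter> space L)"
    by (simp add: distr_density_W)
  also have "\<dots> = emeasure (density L w) (W -` (W_inv -` N \<inter> space L) \<inter> space L)"
    using N(2) by (subst emeasure_distr) (use measurable_sets[OF measurable_W_inv null_setsD2[OF N(2)]] in auto)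
  also have "W -` (W_inv -` N \<inter> space L) \<inter> space L = N"
    using sets.sets_into_space[OF null_setsD2[OF N(2)]] by (auto simp: W_inv_W W_pos)
  also have "emeasure (density L w) N = 0"
    using N(2) by (subst emeasure_density) (auto simp: nn_integral_null_set)
  finally have "W_inv -` N \<inter> space L \<in> null_sets L"
    using measurable_sets[OF measurable_W_inv null_setsD2[OF N(2)]] by auto
  then show ?thesis
    by (rule AE_I') (use N(1) W_inv_pos in auto)
qed

end

section \<open>Means and the change of variables\<close>

text \<open>The average inside the mean is continuous in \<open>x\<close>, being an indefinite
  integral divided by \<open>x\<close>, and it is composed with the Borel function
  \<open>inv_into {0<..} g\<close>.\<close>

lemma mean_measurable:
  assumes cont: "continuous_on {0<..} g"
    and mono: "strict_mono_on {0<..} g \<or> strict_antimono_on {0<..} g"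
    and dfd: "mean_defined g h"
  shows "mean g h \<in> borel_measurable (lebesgue_on {0<..})"
proof -
  define I where "I = (\<lambda>x. integral {0..x} (\<lambda>t. g (h t)))"
  have hi: "((\<lambda>t. g (h t)) has_integral (\<integral>t. g (h t) \<partial>lebesgue_on {0<..<x})) {0..x}" if "0 < x" for x
    using dfd that has_integral_integral_lebesgue_on[of "{0<..<x}" "\<lambda>t. g (h t)"]
    by (simp add: has_integral_Icc_iff_Ioo mean_defined_def)
  have "isCont I x" if "0 < x" for x
  proof -
    \<comment> \<open>The endpoint \<open>x + 1\<close> serves only to put \<open>x\<close> in the
      interior.\<close>
    have "continuous_on {0..x + 1} I"
      unfolding I_def using hi[of "x + 1"] that by (intro indefinite_integral_continuous_1) auto
    then show ?thesis
      using that by (intro continuous_on_interior) auto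
  qed
  then have "continuous_on {0<..} I"
    by (intro continuous_at_imp_continuous_on) auto
  then have "continuous_on {0<..} (\<lambda>x. 1 / x * I x)"
    by (intro continuous_intros) auto
  then have "(\<lambda>x. 1 / x * I x) \<in> borel_measurable (lebesgue_on {0<..})"
    by (intro continuous_imp_measurable_on_sets_lebesgue) auto
  then have "(\<lambda>x. inv_into {0<..} g (1 / x * I x)) \<in> borel_measurable (lebesgue_on {0<..})"
    by (rule measurable_compose)
      (rule borel_measurable_inv_into_strict_mono[OF open_greaterThan cont mono])
  moreover have "mean g h x = inv_into {0<..} g (1 / x * I x)" if "0 < x" for x
    using integral_unique[OF hi[OF that]] by (simp add: mean_def I_def)
  ultimately show ?thesis
    by (subst measurable_cong[where g = "\<lambda>x. inv_into {0<..} g (1 / x * I x)"]) auto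
qed

context divergent_weight
begin

lemma nn_integral_substitution:
  assumes "k \<in> borel_measurable L"
  shows "(\<integral>\<^sup>+y. k y \<partial>L) = (\<integral>\<^sup>+x. ennreal (w x) * k (W x) \<partial>L)"
proof -
  have "(\<integral>\<^sup>+y. k y \<partial>L) = (\<integral>\<^sup>+y. k y \<partial>distr (density L w) L W)"
    by (simp add: distr_density_W)
  also have "\<dots> = (\<integral>\<^sup>+x. k (W x) \<partial>density L w)"
    using assms by (intro nn_integral_distr) auto
  also have "\<dots> = (\<integral>\<^sup>+x. ennreal (w x) * k (W x) \<partial>L)"
    using assms by (intro nn_integral_density) auto
  finally show ?thesis .
qed

text \<open>The pushforward identity is applied to \<open>k\<close> cut off to
  \<open>{0<..<W x}\<close>. The equivalence for integrability transfers the condition that a mean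
  is defined, the equality transfers its value.\<close>

lemma
  fixes k :: "real \<Rightarrow> real"
  assumes k[measurable]: "k \<in> borel_measurable L" and x: "0 < x"
  shows integrable_substitution: "integrable (lebesgue_on {0<..<W x}) k \<longleftrightarrow>
      integrable (lebesgue_on {0<..<x}) (\<lambda>t. w t * k (W t))"
    and integral_substitution: "(\<integral>t. k t \<partial>lebesgue_on {0<..<W x}) =
      (\<integral>t. w t * k (W t) \<partial>lebesgue_on {0<..<x})"
proof -
  have Ioo: "{0<..<y} \<inter> space L \<in> sets L" for y
    by (auto simp: sets_restrict_space_iff)
  have restrict: "lebesgue_on {0<..<y} = restrict_space L {0<..<y}" for y :: real
    by (subst restrict_restrict_space) (auto intro!: arg_cong2[where f = restrict_space])
  have ind[measurable]: "(\<lambda>t. indicator {0<..<W x} t *\<^sub>R k t) \<in> borel_measurable L"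
    using k by (intro borel_measurable_scaleR borel_measurable_indicator)
      (auto simp: sets_restrict_space_iff)
  have indW[measurable]: "(\<lambda>t. indicator {0<..<W x} (W t) *\<^sub>R k (W t)) \<in> borel_measurable L"
    using measurable_compose[OF measurable_W ind] .
  have w_nonneg: "AE t in L. 0 \<le> w t"
    by (rule AE_I2) (simp add: w_pos less_imp_le)
  \<comment> \<open>Since \<open>W\<close> is strictly increasing, \<open>W t\<close> lies below
    \<open>W x\<close> exactly when \<open>t\<close> lies below \<open>x\<close>.\<close>
  have eq: "w t *\<^sub>R indicator {0<..<W x} (W t) *\<^sub>R k (W t) = indicator {0<..<x} t *\<^sub>R (w t * k (W t))"
    if "t \<in> space L" for t
    using that x by (auto simp: W_less_iff W_pos split: split_indicator)
  have "integrable (lebesgue_on {0<..<W x}) k \<longleftrightarrow>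
      integrable (distr (density L w) L W) (\<lambda>t. indicator {0<..<W x} t *\<^sub>R k t)"
    unfolding restrict integrable_restrict_space[OF Ioo] distr_density_W ..
  also have "\<dots> \<longleftrightarrow> integrable (density L w) (\<lambda>t. indicator {0<..<W x} (W t) *\<^sub>R k (W t))"
    by (rule integrable_distr_eq) (use ind in auto)
  also have "\<dots> \<longleftrightarrow> integrable L (\<lambda>t. w t *\<^sub>R indicator {0<..<W x} (W t) *\<^sub>R k (W t))"
    by (rule integrable_density) (use indW w_nonneg in auto)
  also have "\<dots> \<longleftrightarrow> integrable L (\<lambda>t. indicator {0<..<x} t *\<^sub>R (w t * k (W t)))"
    by (rule Bochner_Integration.integrable_cong[OF refl eq])
  also have "\<dots> \<longleftrightarrow> integrable (lebesgue_on {0<..<x}) (\<lambda>t. w t * k (W t))"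
    unfolding restrict integrable_restrict_space[OF Ioo] ..
  finally show "integrable (lebesgue_on {0<..<W x}) k \<longleftrightarrow>
      integrable (lebesgue_on {0<..<x}) (\<lambda>t. w t * k (W t))" .
  have "(\<integral>t. k t \<partial>lebesgue_on {0<..<W x}) =
      (\<integral>t. indicator {0<..<W x} t *\<^sub>R k t \<partial>distr (density L w) L W)"
    unfolding restrict integral_restrict_space[OF Ioo] distr_density_W ..
  also have "\<dots> = (\<integral>t. indicator {0<..<W x} (W t) *\<^sub>R k (W t) \<partial>density L w)"
    by (rule integral_distr) (use ind in auto)
  also have "\<dots> = (\<integral>t. w t *\<^sub>R indicator {0<..<W x} (W t) *\<^sub>R k (W t) \<partial>L)"
    by (rule integral_density) (use indW w_nonneg in auto)
  also have "\<dots> = (\<integral>t. indicator {0<..<x} t *\<^sub>R (w t * k (W t)) \<partial>L)"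
    by (rule Bochner_Integration.integral_cong[OF refl eq])
  also have "\<dots> = (\<integral>t. w t * k (W t) \<partial>lebesgue_on {0<..<x})"
    unfolding restrict integral_restrict_space[OF Ioo] ..
  finally show "(\<integral>t. k t \<partial>lebesgue_on {0<..<W x}) =
      (\<integral>t. w t * k (W t) \<partial>lebesgue_on {0<..<x})" .
qed

text \<open>The substitution contributes a factor \<open>w x\<close>, which cancels the denominator
  of \<open>change_weight\<close> at \<open>W x\<close>. Both sides of the inequality are instances,
  one with \<open>u\<close> and one with \<open>v\<close>.\<close>

lemma nn_integral_change_weight:
  fixes k :: "real \<Rightarrow> real"
  assumes u: "pos_measurable u" and k[measurable]: "k \<in> borel_measurable L"
  shows "(\<integral>\<^sup>+y. ennreal (change_weight w u y * k y) \<partial>L) = (\<integral>\<^sup>+x. ennreal (u x * k (W x)) \<partial>L)"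
proof -
  have u_meas: "u \<in> borel_measurable L" using u by (simp add: pos_measurable_def)
  have [measurable]: "(\<lambda>y. u (W_inv y)) \<in> borel_measurable L" "(\<lambda>y. w (W_inv y)) \<in> borel_measurable L"
    using measurable_compose[OF measurable_W_inv u_meas] measurable_compose[OF measurable_W_inv w_measurable] by auto
  \<comment> \<open>Replacing \<open>deriv W\<close> by \<open>w\<close> almost everywhere yields an
    integrand built from functions known to be measurable, as the substitution requires.\<close>
  have "(\<integral>\<^sup>+y. ennreal (change_weight w u y * k y) \<partial>L) =
      (\<integral>\<^sup>+y. ennreal (u (W_inv y) / w (W_inv y) * k y) \<partial>L)"
    by (intro nn_integral_cong_AE eventually_mono[OF AE_W_inv[OF AE_deriv_W]])
      (simp add: change_weight_def)
  also have "\<dots> = (\<integral>\<^sup>+x. ennreal (w x) * ennreal (u (W_inv (W x)) / w (W_inv (W x)) * k (W x)) \<partial>L)"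
    by (intro nn_integral_substitution) measurable
  also have "\<dots> = (\<integral>\<^sup>+x. ennreal (u x * k (W x)) \<partial>L)"
  proof (rule nn_integral_cong)
    fix x assume "x \<in> space L"
    then have "0 < x" by simp
    \<comment> \<open>\<open>ennreal_mult'\<close> asks for a nonnegative sign of \<open>w x\<close>
      alone, so \<open>k\<close> may be negative.\<close>
    then show "ennreal (w x) * ennreal (u (W_inv (W x)) / w (W_inv (W x)) * k (W x)) = ennreal (u x * k (W x))"
      using w_pos[of x] by (simp add: W_inv_W flip: ennreal_mult')
  qed
  finally show ?thesis .
qed

lemma pos_measurable_compose_W: "pos_measurable h \<Longrightarrow> pos_measurable (\<lambda>x. h (W x))"
  and pos_measurable_compose_W_inv: "pos_measurable h \<Longrightarrow> pos_measurable (\<lambda>x. h (W_inv x))"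
  using measurable_compose[OF measurable_W] measurable_compose[OF measurable_W_inv]
  by (auto simp: pos_measurable_def W_pos W_inv_pos)

lemma
  assumes cont: "continuous_on {0<..} g" and h: "pos_measurable h"
  shows wmean_defined_compose_W: "wmean_defined g w (\<lambda>x. h (W x)) \<longleftrightarrow> mean_defined g h"
    and wmean_compose_W: "0 < x \<Longrightarrow> wmean g w (\<lambda>x. h (W x)) x = mean g h (W x)"
proof -
  \<comment> \<open>As \<open>g\<close> is continuous on \<open>{0<..}\<close> only,
    \<open>h\<close> is viewed as a map into that subspace before composing.\<close>
  have "h \<in> L \<rightarrow>\<^sub>M restrict_space borel {0<..}"
    using h by (auto simp: pos_measurable_def intro!: measurable_restrict_space2)
  then have gh: "(\<lambda>t. g (h t)) \<in> borel_measurable L"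
    by (rule measurable_compose) (rule borel_measurable_continuous_on_restrict[OF cont])
  \<comment> \<open>\<open>W\<close> maps \<open>{0<..}\<close> onto itself, so every right endpoint
    has the form \<open>W x\<close>.\<close>
  have "mean_defined g h \<longleftrightarrow> (\<forall>x>0. integrable (lebesgue_on {0<..<W x}) (\<lambda>t. g (h t)))"
    unfolding mean_defined_def by (metis W_pos W_inv_pos W_W_inv)
  then show "wmean_defined g w (\<lambda>x. h (W x)) \<longleftrightarrow> mean_defined g h"
    using integrable_substitution[OF gh] by (simp add: wmean_defined_def)
  show "wmean g w (\<lambda>x. h (W x)) x = mean g h (W x)" if "0 < x"
    using integral_substitution[OF gh that] by (simp add: wmean_def mean_def)
qed

text \<open>Each \<open>f\<close> agrees on \<open>{0<..}\<close> with \<open>h\<close> composed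
  with \<open>W\<close>, where \<open>h\<close> is \<open>f\<close> composed with
  \<open>W_inv\<close>. The two may differ elsewhere, so \<open>P\<close> has to ignore values
  outside \<open>{0<..}\<close>.\<close>

lemma all_pos_measurable_iff:
  assumes "\<And>f f'. (\<And>x. 0 < x \<Longrightarrow> f x = f' x) \<Longrightarrow> P f \<Longrightarrow> P f'"
  shows "(\<forall>f. pos_measurable f \<longrightarrow> P f) \<longleftrightarrow> (\<forall>h. pos_measurable h \<longrightarrow> P (\<lambda>x. h (W x)))"
proof (intro iffI allI impI)
  fix f assume *: "\<forall>h. pos_measurable h \<longrightarrow> P (\<lambda>x. h (W x))" "pos_measurable f"
  then have "P (\<lambda>x. f (W_inv (W x)))"
    using pos_measurable_compose_W_inv by blast
  then show "P f"
    by (rule assms[rotated]) (simp add: W_inv_W)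
qed (use pos_measurable_compose_W in blast)

end

section \<open>Equivalence of the two inequalities\<close>

lemma wmean_cong_pos:
  assumes "\<And>x. 0 < x \<Longrightarrow> f x = f' x"
  shows "wmean_defined g w f = wmean_defined g w f'" "wmean g w f x = wmean g w f' x"
proof -
  have eq: "w t * g (f t) = w t * g (f' t)" if "t \<in> space (lebesgue_on {0<..<y})" for t y
    using that assms by simp
  have "integrable (lebesgue_on {0<..<y}) (\<lambda>t. w t * g (f t)) \<longleftrightarrow>
      integrable (lebesgue_on {0<..<y}) (\<lambda>t. w t * g (f' t))" for y
    by (rule Bochner_Integration.integrable_cong[OF refl eq])
  then show "wmean_defined g w f = wmean_defined g w f'"
    by (simp only: wmean_defined_def)
  have "(\<integral>t. w t * g (f t) \<partial>lebesgue_on {0<..<x}) = (\<integral>t. w t * g (f' t) \<partial>lebesgue_on {0<..<x})"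
    by (rule Bochner_Integration.integral_cong[OF refl eq])
  then show "wmean g w f x = wmean g w f' x"
    by (simp only: wmean_def)
qed

theorem lemma3p1:
  fixes p q C :: real and u v w g :: "real \<Rightarrow> real"
  assumes "0 < p" and "0 < q" and "0 < C"
    and "pos_measurable u" and "pos_measurable v"
    and "continuous_on {0<..} g"
    and "strict_mono_on {0<..} g \<or> strict_antimono_on {0<..} g"
    and "pos_measurable w"
    and "\<forall>x>0. (\<integral>\<^sup>+s. ennreal (w s) \<partial>lebesgue_on {0<..<x}) < \<infinity>"
    and "(\<integral>\<^sup>+s. ennreal (w s) \<partial>lebesgue_on {0<..}) = \<infinity>"
  shows
    "(\<forall>f. pos_measurable f \<and> wmean_defined g w f \<longrightarrow>
        ennpow (\<integral>\<^sup>+x. ennreal (u x * wmean g w f x powr q) \<partial>lebesgue_on {0<..}) (1 / q)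
        \<le> ennreal C * ennpow (\<integral>\<^sup>+x. ennreal (v x * f x powr p) \<partial>lebesgue_on {0<..}) (1 / p))
     \<longleftrightarrow>
     (\<forall>f. pos_measurable f \<and> mean_defined g f \<longrightarrow>
        ennpow (\<integral>\<^sup>+x. ennreal (change_weight w u x * mean g f x powr q) \<partial>lebesgue_on {0<..}) (1 / q)
        \<le> ennreal C * ennpow (\<integral>\<^sup>+x. ennreal (change_weight w v x * f x powr p) \<partial>lebesgue_on {0<..}) (1 / p))"
proof -
  interpret divergent_weight w
    using assms by unfold_locales auto
  define P where "P f \<longleftrightarrow> (wmean_defined g w f \<longrightarrow>
      ennpow (\<integral>\<^sup>+x. ennreal (u x * wmean g w f x powr q) \<partial>L) (1 / q)
      \<le> ennreal C * ennpow (\<integral>\<^sup>+x. ennreal (v x * f x powr p) \<partial>L) (1 / p))" for f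
  define Q where "Q h \<longleftrightarrow> (mean_defined g h \<longrightarrow>
      ennpow (\<integral>\<^sup>+x. ennreal (change_weight w u x * mean g h x powr q) \<partial>L) (1 / q)
      \<le> ennreal C * ennpow (\<integral>\<^sup>+x. ennreal (change_weight w v x * h x powr p) \<partial>L) (1 / p))" for h
  \<comment> \<open>This is the invariance that \<open>all_pos_measurable_iff\<close> asks of
    \<open>P\<close>.\<close>
  have P_cong: "P f'" if "\<And>x. 0 < x \<Longrightarrow> f x = f' x" "P f" for f f'
  proof -
    have "(\<integral>\<^sup>+x. ennreal (v x * f x powr p) \<partial>L) = (\<integral>\<^sup>+x. ennreal (v x * f' x powr p) \<partial>L)"
      by (rule nn_integral_cong) (simp add: that(1))
    then show ?thesis
      using that(2) wmean_cong_pos[of f f' g w, OF that(1)] unfolding P_def by simp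
  qed
  have "P (\<lambda>x. h (W x)) \<longleftrightarrow> Q h" if h: "pos_measurable h" for h
  \<comment> \<open>\<open>mean_measurable\<close> needs the mean to be defined; otherwise both
    implications hold vacuously.\<close>
  proof (cases "mean_defined g h")
    case True
    note compose = wmean_compose_W[OF assms(6) h]
    have h_meas: "h \<in> borel_measurable L" using h by (simp add: pos_measurable_def)
    \<comment> \<open>The two integrals on each side turn out equal, so the constant
      \<open>C\<close> is unchanged.\<close>
    have "(\<integral>\<^sup>+x. ennreal (u x * wmean g w (\<lambda>x. h (W x)) x powr q) \<partial>L) =
        (\<integral>\<^sup>+x. ennreal (u x * mean g h (W x) powr q) \<partial>L)"
      by (rule nn_integral_cong) (simp add: compose)
    also have "\<dots> = (\<integral>\<^sup>+x. ennreal (change_weight w u x * mean g h x powr q) \<partial>L)"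
      using mean_measurable[OF assms(6,7) True]
      by (intro nn_integral_change_weight[symmetric] assms powr_real_measurable) auto
    finally have left: "(\<integral>\<^sup>+x. ennreal (u x * wmean g w (\<lambda>x. h (W x)) x powr q) \<partial>L) =
        (\<integral>\<^sup>+x. ennreal (change_weight w u x * mean g h x powr q) \<partial>L)" .
    have right: "(\<integral>\<^sup>+x. ennreal (v x * h (W x) powr p) \<partial>L) =
        (\<integral>\<^sup>+x. ennreal (change_weight w v x * h x powr p) \<partial>L)"
      using h_meas by (intro nn_integral_change_weight[symmetric] assms powr_real_measurable) auto
    show ?thesis
      unfolding P_def Q_def left right by (simp add: wmean_defined_compose_W[OF assms(6) h])
  next
    case False
    then show ?thesis
      by (simp add: P_def Q_def wmean_defined_compose_W[OF assms(6) h])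
  qed
  then have "(\<forall>f. pos_measurable f \<longrightarrow> P f) \<longleftrightarrow> (\<forall>h. pos_measurable h \<longrightarrow> Q h)"
    using all_pos_measurable_iff[of P] P_cong by blast
  then show ?thesis
    by (simp add: P_def Q_def imp_conjL)
qed

end
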